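(* Let $f:I\subseteq\mathbb{R}\to\mathbb{R}$ and let $\zeta$ be a root of $f$, i.e. $f(\zeta)=0$. The iterative method $$x_{n+1}=x_n+\frac{\mathfrak{H}_{\varkappa}(x_n)}{h_{0,1}(x_n)},\qquad \varkappa=-r\!\left(\frac{h_{0,2}(x_n)}{h_{0,1}^2(x_n)}\right),$$ for solving $f(x)=0$ is of quadratic convergence. If $x_n$ is sufficiently close to the actual root $\zeta$, then the error $e_{n+1}$ of iteration step $n+1$, defined via $e_{n+1}=x_{n+1}-\zeta$, fulfills the error equation $$e_{n+1}=\frac{h_{\varkappa,2}(\zeta)}{2h_{0,1}(\zeta)}\,e_n^2 .$$
   Context: Here $n\in\mathbb{N}\cup\{0\}$, $x_0$ is an initial guess, and $e_n=x_n-\zeta$. $\sigma(z)$ gives the sign of the real number $z$, and $r(a)$ rounds $a$ to the closest integer. The generalized moment generating function of degree $0$ is $\mathcal{H}_0(x_n,\xi_n)=-\sigma(f(x_n))\,\bigl(f(x_n+\xi_n)-f(x_n)\bigr)$, where $\xi_n=x_{n+1}-x_n$. Those of arbitrary degree $k\in\mathbb{Z}$ are defined recursively via $\mathcal{H}_k(x_n,\xi_n)=\ln\left[1+\mathcal{H}_{k+1}(x_n,\xi_n)\right]$. The generalized moments of degree $k$ and order $l$ are $h_{k,l}(x_n)=\left.\dfrac{\partial^l\mathcal{H}_k(x_n,\xi_n)}{\partial\xi_n^l}\right|_{\xi_n=0}$. The value $\mathfrak{H}_k(x_n)$ is obtained by setting $f(x_n+\xi_n)=0$ in the definition of $\mathcal{H}_k(x_n,\xi_n)$;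 thus $\mathfrak{H}_0(x_n)=|f(x_n)|$ and $\mathfrak{H}_k(x_n)=\ln\left[1+\mathfrak{H}_{k+1}(x_n)\right]$ for $k\in\mathbb{Z}$.
   Formalization: Assumes f is C² near ζ, ζ is interior to I and f'(ζ)≠0; the error equation holds up to o(e_n²), not exactly; since σ(f(ζ))=0, the moments at ζ are read as one-sided limits from the side of x_n, with ϰ taken at x_n. *)

theory Defs
  imports "HOL-Analysis.Analysis" "HOL-Library.Landau_Symbols"
begin

(* The paper's recursion H_k = ln (1 + H_(k+1)), k an integer, as a map H_0 |-> H_k:
   solved for H_(k+1) it gives the upward step t |-> exp t - 1. *)
definition degree_shift :: "int \<Rightarrow> real \<Rightarrow> real" where
  "degree_shift k t =
     (if k \<ge> 0 then ((\<lambda>s. exp s - 1) ^^ nat k) t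
      else ((\<lambda>s. ln (1 + s)) ^^ nat (- k)) t)"

lemma degree_shift_0 [simp]: "degree_shift 0 t = t"
  by (simp add: degree_shift_def)

lemma degree_shift_rec: "degree_shift k t = ln (1 + degree_shift (k + 1) t)"
proof (cases "k \<ge> 0")
  case True
  then have "nat (k + 1) = Suc (nat k)" by simp
  with True show ?thesis by (simp add: degree_shift_def)
next
  case False
  then have *: "nat (- k) = Suc (nat (- (k + 1)))" by simp
  have "degree_shift k t = ln (1 + ((\<lambda>s. ln (1 + s)) ^^ nat (- (k + 1))) t)"
    using False unfolding degree_shift_def * by simp
  moreover have "degree_shift (k + 1) t = ((\<lambda>s. ln (1 + s)) ^^ nat (- (k + 1))) t"
    using False by (cases "k = -1") (auto simp: degree_shift_def)
  ultimately show ?thesis by simp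
qed

lemma degree_shift_unique:
  assumes "\<And>k. 1 + G k > 0" and "\<And>k. G k = ln (1 + G (k + 1))"
  shows "G k = degree_shift k (G 0)"
proof (induction k rule: int_induct[where k = 0])
  case base
  then show ?case by simp
next
  case (step1 i)
  have "G (i + 1) = exp (G i) - 1"
    using assms(1)[of "i + 1"] assms(2)[of i] by simp
  moreover have "nat (i + 1) = Suc (nat i)" using step1 by simp
  ultimately show ?case using step1 by (simp add: degree_shift_def)
next
  case (step2 i)
  then show ?case
    using assms(2)[of "i - 1"] degree_shift_rec[of "i - 1" "G 0"] by simp
qed

definition gen_mgf :: "(real \<Rightarrow> real) \<Rightarrow> int \<Rightarrow> real \<Rightarrow> real \<Rightarrow> real" where
  "gen_mgf f k x \<xi> = degree_shift k (- sgn (f x) * (f (x + \<xi>) - f x))"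

lemma gen_mgf_0: "gen_mgf f 0 x \<xi> = - sgn (f x) * (f (x + \<xi>) - f x)"
  by (simp add: gen_mgf_def)

lemma gen_mgf_rec: "gen_mgf f k x \<xi> = ln (1 + gen_mgf f (k + 1) x \<xi>)"
  unfolding gen_mgf_def by (rule degree_shift_rec)

definition gen_moment :: "(real \<Rightarrow> real) \<Rightarrow> int \<Rightarrow> nat \<Rightarrow> real \<Rightarrow> real" where
  "gen_moment f k l x = (deriv ^^ l) (\<lambda>\<xi>. gen_mgf f k x \<xi>) 0"

definition root_value :: "(real \<Rightarrow> real) \<Rightarrow> int \<Rightarrow> real \<Rightarrow> real" where
  "root_value f k x = degree_shift k \<bar>f x\<bar>"

lemma root_value_0: "root_value f 0 x = \<bar>f x\<bar>"
  by (simp add: root_value_def)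

lemma root_value_rec: "root_value f k x = ln (1 + root_value f (k + 1) x)"
  unfolding root_value_def by (rule degree_shift_rec)

lemma root_value_eq_gen_mgf: "f (x + \<xi>) = 0 \<Longrightarrow> root_value f k x = gen_mgf f k x \<xi>"
  by (simp add: root_value_def gen_mgf_def abs_sgn mult.commute)

(* Library round breaks ties upwards. *)
definition step_degree :: "(real \<Rightarrow> real) \<Rightarrow> real \<Rightarrow> int" where
  "step_degree f x = - round (gen_moment f 0 2 x / (gen_moment f 0 1 x)\<^sup>2)"

definition next_iterate :: "(real \<Rightarrow> real) \<Rightarrow> real \<Rightarrow> real" where
  "next_iterate f x = x + root_value f (step_degree f x) x / gen_moment f 0 1 x"

(* The moments h_(k,l)(\<zeta>) in the error equation.  Because of the factor sgn (f x), the
   moments jump at a simple root \<zeta> and vanish there (sgn 0 = 0), so their plain values at \<zeta>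
   would give 0 / 0.  They are read as limits at \<zeta> from the side on which the current
   iterate x lies, that is, with the sign that f has at x. *)
definition moment_at_root :: "(real \<Rightarrow> real) \<Rightarrow> int \<Rightarrow> nat \<Rightarrow> real \<Rightarrow> real \<Rightarrow> real" where
  "moment_at_root f k l \<zeta> x =
     Lim (if x < \<zeta> then at_left \<zeta> else at_right \<zeta>) (\<lambda>y. gen_moment f k l y)"

end

theory Submission
  imports Defs
begin

text \<open>The map \<^term>\<open>degree_shift k\<close> has the expansion \<open>t + k t^2 / 2 + o(t^2)\<close> at 0, because second
  derivatives at 0 add up under composition of maps that are tangent to the identity. With
  \<open>u = x - \<zeta>\<close>, \<open>s = sgn (f x)\<close> and a fixed degree \<open>k\<close>, inserting the Taylor expansion of \<open>f\<close> at the
  root into \<open>x - \<zeta> - s D_k(|f x|) / f' x\<close> cancels the terms of order one and leaves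
  \<open>(f'' \<zeta> / (2 f' \<zeta>) - s k f' \<zeta> / 2) u^2 + o(u^2)\<close>, which is the asserted error term.
  The degree chosen by the method depends on \<open>x\<close>, but it is the rounding of a quantity that is
  bounded near the root, so only finitely many degrees occur and the remainder is uniform.\<close>

section \<open>Second-order jets at a point\<close>

text \<open>The first derivative is required on a neighbourhood of \<open>p\<close>, which makes the
  second derivative at \<open>p\<close> meaningful; the second derivative itself is recorded at
  \<open>p\<close> only.\<close>

definition jet2 :: "(real \<Rightarrow> real) \<Rightarrow> real \<Rightarrow> real \<Rightarrow> real \<Rightarrow> bool" where
  "jet2 g p b a \<longleftrightarrow> (\<exists>g'. (\<forall>\<^sub>F t in nhds p. (g has_real_derivative g' t) (at t)) \<and> g' p = b
      \<and> (g' has_real_derivative a) (at p))"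

lemma jet2I:
  assumes "\<forall>\<^sub>F t in nhds p. (g has_real_derivative g' t) (at t)"
    and "(g' has_real_derivative a) (at p)"
  shows "jet2 g p (g' p) a"
  using assms unfolding jet2_def by blast

lemma jet2_imp_DERIV: "jet2 g p b a \<Longrightarrow> (g has_real_derivative b) (at p)"
  unfolding jet2_def using eventually_nhds_x_imp_x by blast

text \<open>Chain rule for \<open>g\<close>, then product and chain rule for the derivative
  \<open>h' (g t) * g' t\<close>. With \<open>b = d = 1\<close> the second derivative is
  \<open>c + a\<close>.\<close>

lemma jet2_compose:
  assumes "jet2 g p b a" "jet2 h (g p) d c"
  shows "jet2 (\<lambda>t. h (g t)) p (d * b) (c * b\<^sup>2 + d * a)"
proof -
  obtain g' where g: "\<forall>\<^sub>F t in nhds p. (g has_real_derivative g' t) (at t)" "g' p = b"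
    "(g' has_real_derivative a) (at p)"
    using assms(1) unfolding jet2_def by blast
  obtain h' where h: "\<forall>\<^sub>F t in nhds (g p). (h has_real_derivative h' t) (at t)" "h' (g p) = d"
    "(h' has_real_derivative c) (at (g p))"
    using assms(2) unfolding jet2_def by blast
  have gp: "(g has_real_derivative b) (at p)"
    using jet2_imp_DERIV[OF assms(1)] .
  \<comment> \<open>Continuity of \<open>g\<close> at \<open>p\<close> pulls the neighbourhood of
    \<open>g p\<close> on which \<open>h\<close> is differentiable back to one of
    \<open>p\<close>.\<close>
  have "filterlim g (nhds (g p)) (nhds p)"
    using DERIV_isCont[OF gp] by (simp add: isCont_def tendsto_at_iff_tendsto_nhds)
  then have "\<forall>\<^sub>F t in nhds p. (h has_real_derivative h' (g t)) (at (g t))"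
    using h(1) unfolding filterlim_iff by blast
  then have 1: "\<forall>\<^sub>F t in nhds p. ((\<lambda>t. h (g t)) has_real_derivative h' (g t) * g' t) (at t)"
    using g(1) by eventually_elim (rule DERIV_chain2)
  have 2: "((\<lambda>t. h' (g t) * g' t) has_real_derivative c * b * g' p + a * h' (g p)) (at p)"
    by (rule DERIV_mult[OF DERIV_chain2[where f = h' and g = g, OF h(3) gp] g(3)])
  show ?thesis
    using jet2I[OF 1 2] g(2) h(2) by (simp add: power2_eq_square ac_simps)
qed

lemma jet2_deriv:
  assumes "jet2 g p b a"
  shows "deriv g p = b" "(deriv ^^ 2) g p = a"
proof -
  obtain g' where g: "\<forall>\<^sub>F t in nhds p. (g has_real_derivative g' t) (at t)" "g' p = b"
    "(g' has_real_derivative a) (at p)"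
    using assms unfolding jet2_def by blast
  show "deriv g p = b"
    using jet2_imp_DERIV[OF assms] by (rule DERIV_imp_deriv)
  \<comment> \<open>Agreement of \<open>deriv g\<close> with \<open>g'\<close> near \<open>p\<close>
    suffices, since a derivative at \<open>p\<close> depends only on the germ there.\<close>
  have "\<forall>\<^sub>F t in nhds p. deriv g t = g' t"
    using g(1) by eventually_elim (rule DERIV_imp_deriv)
  then have "deriv (deriv g) p = deriv g' p"
    by (rule deriv_cong_ev) simp
  also have "\<dots> = a"
    using g(3) by (rule DERIV_imp_deriv)
  finally show "(deriv ^^ 2) g p = a"
    by (simp add: numeral_2_eq_2)
qed

text \<open>Taylor's formula with Peano remainder. One use of l'Hopital's rule leaves half the
  difference quotient of \<open>g'\<close> at \<open>p\<close>, which converges to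
  \<open>a / 2\<close>.\<close>

lemma jet2_taylor:
  assumes "jet2 g p b a"
  shows "((\<lambda>t. (g t - g p - b * (t - p)) / (t - p)\<^sup>2) \<longlongrightarrow> a / 2) (at p)"
proof -
  obtain g' where g: "\<forall>\<^sub>F t in nhds p. (g has_real_derivative g' t) (at t)" "g' p = b"
    "(g' has_real_derivative a) (at p)"
    using assms unfolding jet2_def by blast
  have cont: "(g \<longlongrightarrow> g p) (at p)"
    using DERIV_isCont[OF jet2_imp_DERIV[OF assms]] by (simp add: isCont_def)
  have ev: "\<forall>\<^sub>F t in at p. t \<noteq> p"
    by (simp add: eventually_at_filter)
  have "((\<lambda>t. (g' t - g' p) / (t - p)) \<longlongrightarrow> a) (at p)"
    using g(3) by (simp add: has_field_derivative_iff)
  then have "((\<lambda>t. (g' t - g' p) / (t - p) / 2) \<longlongrightarrow> a / 2) (at p)"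
    by (intro tendsto_intros) auto
  then have lim: "((\<lambda>t. (g' t - b) / (2 * (t - p))) \<longlongrightarrow> a / 2) (at p)"
    by (simp add: g(2) mult.commute)
  show ?thesis
  proof (rule lhopital[OF _ _ _ _ _ _ lim])
    have "((\<lambda>t. g t - g p - b * (t - p)) \<longlongrightarrow> g p - g p - b * (p - p)) (at p)"
      by (intro tendsto_intros cont)
    then show "((\<lambda>t. g t - g p - b * (t - p)) \<longlongrightarrow> 0) (at p)" by simp
    have "((\<lambda>t. (t - p)\<^sup>2) \<longlongrightarrow> (p - p)\<^sup>2) (at p)"
      by (intro tendsto_intros)
    then show "((\<lambda>t. (t - p)\<^sup>2) \<longlongrightarrow> 0) (at p)" by simp
    show "\<forall>\<^sub>F t in at p. (t - p)\<^sup>2 \<noteq> 0" "\<forall>\<^sub>F t in at p. 2 * (t - p) \<noteq> 0"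
      using ev by (auto elim: eventually_mono)
    have "\<forall>\<^sub>F t in at p. (g has_real_derivative g' t) (at t)"
      using g(1) by (simp add: eventually_nhds_conv_at)
    then show "\<forall>\<^sub>F t in at p. ((\<lambda>t. g t - g p - b * (t - p)) has_real_derivative g' t - b) (at t)"
      by eventually_elim (auto intro!: derivative_eq_intros)
    show "\<forall>\<^sub>F t in at p. ((\<lambda>t. (t - p)\<^sup>2) has_real_derivative 2 * (t - p)) (at t)"
      by (intro always_eventually allI) (auto intro!: derivative_eq_intros)
  qed
qed

lemma jet2_funpow:
  assumes "g 0 = 0" "jet2 g 0 1 a"
  shows "(g ^^ n) 0 = 0 \<and> jet2 (g ^^ n) 0 1 (real n * a)"
proof (induction n)
  case 0
  show ?case
    using jet2I[of id "\<lambda>_. 1" 0 0] by (simp add: id_def)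
next
  case (Suc n)
  then show ?case
    using jet2_compose[of "g ^^ n" 0 1 "real n * a" g 1 a] assms
    by (simp add: algebra_simps comp_def)
qed

section \<open>Jets of the degree shift and the generalized moments\<close>

lemma degree_shift_at_0 [simp]: "degree_shift k 0 = 0"
proof -
  have "((\<lambda>s::real. exp s - 1) ^^ n) 0 = 0" "((\<lambda>s::real. ln (1 + s)) ^^ n) 0 = 0" for n
    by (induction n) auto
  then show ?thesis by (simp add: degree_shift_def)
qed

text \<open>At 0 the upward step \<open>exp s - 1\<close> has second derivative 1 and the downward
  step \<open>ln (1 + s)\<close> has -1, so the iterate yields \<open>k\<close> for either sign of
  \<open>k\<close>.\<close>

lemma jet2_degree_shift: "jet2 (degree_shift k) 0 1 (of_int k)"
proof -
  have "jet2 (\<lambda>s. exp s - 1) 0 (exp 0) 1"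
    by (rule jet2I[where g' = exp]) (auto intro!: always_eventually derivative_eq_intros)
  then have e: "jet2 (\<lambda>s. exp s - 1) 0 1 1" by simp
  have "\<forall>\<^sub>F t in nhds (0::real). t \<in> {-1<..}"
    by (intro eventually_nhds_in_open) auto
  then have "\<forall>\<^sub>F t in nhds 0. ((\<lambda>s. ln (1 + s)) has_real_derivative 1 / (1 + t)) (at t)"
    by eventually_elim (auto intro!: derivative_eq_intros)
  moreover have "((\<lambda>t. 1 / (1 + t)) has_real_derivative -1) (at 0)"
    by (auto intro!: derivative_eq_intros)
  ultimately have "jet2 (\<lambda>s. ln (1 + s)) 0 (1 / (1 + 0)) (-1)"
    by (rule jet2I)
  then have l: "jet2 (\<lambda>s. ln (1 + s)) 0 1 (-1)" by simp
  show ?thesis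
  proof (cases "k \<ge> 0")
    case True
    then have "degree_shift k = (\<lambda>s. exp s - 1) ^^ nat k"
      by (auto simp: degree_shift_def fun_eq_iff)
    then show ?thesis
      using jet2_funpow[OF _ e, of "nat k"] True by simp
  next
    case False
    then have "degree_shift k = (\<lambda>s. ln (1 + s)) ^^ nat (- k)"
      by (auto simp: degree_shift_def fun_eq_iff)
    then show ?thesis
      using jet2_funpow[OF _ l, of "nat (- k)"] False by simp
  qed
qed

text \<open>As a function of \<open>\<xi>\<close>, \<open>gen_mgf f k x\<close> is a translation
  followed by \<open>f\<close>, an affine map and \<open>degree_shift k\<close>. The sign of
  \<open>f x\<close> is constant in \<open>\<xi>\<close>, and the inner value at
  \<open>\<xi> = 0\<close> is 0, where the jet of \<open>degree_shift k\<close> is known.\<close>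

lemma gen_moment_jet2:
  assumes "jet2 f x b a"
  shows "gen_moment f k 1 x = - sgn (f x) * b"
    and "gen_moment f k 2 x = of_int k * (sgn (f x) * b)\<^sup>2 - sgn (f x) * a"
proof -
  define s where "s = sgn (f x)"
  have shift: "jet2 (\<lambda>\<xi>. x + \<xi>) 0 1 0"
    by (rule jet2I[where g' = "\<lambda>_. 1"]) (auto intro!: always_eventually derivative_eq_intros)
  have inner: "jet2 (\<lambda>\<xi>. f (x + \<xi>)) 0 b a"
    using jet2_compose[OF shift, of f b a] assms by simp
  have affine: "jet2 (\<lambda>y. - s * (y - f x)) (f x) (- s) 0"
    by (rule jet2I[where g' = "\<lambda>_. - s"]) (auto intro!: always_eventually derivative_eq_intros)
  have "jet2 (\<lambda>\<xi>. - s * (f (x + \<xi>) - f x)) 0 (- s * b) (- s * a)"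
    using jet2_compose[OF inner, of "\<lambda>y. - s * (y - f x)" "- s" 0] affine by simp
  then have "jet2 (gen_mgf f k x) 0 (- s * b) (of_int k * (s * b)\<^sup>2 - s * a)"
    using jet2_compose[of "\<lambda>\<xi>. - s * (f (x + \<xi>) - f x)" 0 "- s * b" "- s * a"
        "degree_shift k" 1 "of_int k"] jet2_degree_shift[of k]
    by (simp add: gen_mgf_def[abs_def] s_def)
  from jet2_deriv[OF this]
  show "gen_moment f k 1 x = - sgn (f x) * b"
    and "gen_moment f k 2 x = of_int k * (sgn (f x) * b)\<^sup>2 - sgn (f x) * a"
    by (simp_all add: gen_moment_def s_def)
qed

section \<open>Signs and limits near a simple root\<close>

locale simple_root =
  fixes f f' f'' :: "real \<Rightarrow> real" and S :: "real set" and \<zeta> :: real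
  assumes open_S: "open S" and root_in: "\<zeta> \<in> S"
    and DERIV_f: "x \<in> S \<Longrightarrow> (f has_real_derivative f' x) (at x)"
    and DERIV_f': "x \<in> S \<Longrightarrow> (f' has_real_derivative f'' x) (at x)"
    and cont_f'': "continuous_on S f''"
    and root: "f \<zeta> = 0" and simple: "f' \<zeta> \<noteq> 0"
begin

lemma jet2_f:
  assumes "x \<in> S"
  shows "jet2 f x (f' x) (f'' x)"
proof (rule jet2I)
  show "\<forall>\<^sub>F t in nhds x. (f has_real_derivative f' t) (at t)"
    using eventually_nhds_in_open[OF open_S assms] by eventually_elim (rule DERIV_f)
qed (rule DERIV_f'[OF assms])

lemma eventually_in_S: "\<forall>\<^sub>F x in at \<zeta>. x \<in> S"
  using eventually_at_in_open'[OF open_S root_in] .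

lemma eventually_ne: "\<forall>\<^sub>F x in at \<zeta>. x \<noteq> \<zeta>"
  by (simp add: eventually_at_filter)

lemma tendsto_f: "(f \<longlongrightarrow> 0) (at \<zeta>)"
  using DERIV_isCont[OF DERIV_f[OF root_in]] by (simp add: isCont_def root)

lemma tendsto_f': "(f' \<longlongrightarrow> f' \<zeta>) (at \<zeta>)"
  using DERIV_isCont[OF DERIV_f'[OF root_in]] by (simp add: isCont_def)

lemma tendsto_f'': "(f'' \<longlongrightarrow> f'' \<zeta>) (at \<zeta>)"
  using cont_f'' open_S root_in by (simp add: continuous_on_eq_continuous_at isCont_def)

lemma slope_tendsto: "((\<lambda>x. f x / (x - \<zeta>)) \<longlongrightarrow> f' \<zeta>) (at \<zeta>)"
  using DERIV_f[OF root_in] by (simp add: has_field_derivative_iff root)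

lemma eventually_sgn: "\<forall>\<^sub>F x in at \<zeta>. sgn (f x) = sgn (f' \<zeta>) * sgn (x - \<zeta>)"
proof -
  \<comment> \<open>The factor \<open>f' \<zeta>\<close> makes the limit of the slope positive for
    either sign of \<open>f' \<zeta>\<close>, so one inequality covers both cases.\<close>
  have "((\<lambda>x. f x / (x - \<zeta>) * f' \<zeta>) \<longlongrightarrow> f' \<zeta> * f' \<zeta>) (at \<zeta>)"
    by (intro tendsto_intros slope_tendsto)
  moreover have "f' \<zeta> * f' \<zeta> > 0" using simple by (auto simp: zero_less_mult_iff)
  ultimately have "\<forall>\<^sub>F x in at \<zeta>. f x / (x - \<zeta>) * f' \<zeta> > 0"
    by (rule order_tendstoD(1))
  then show ?thesis
    by eventually_elim (auto simp: sgn_if zero_less_mult_iff zero_less_divide_iff mult_less_0_iff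
        divide_less_0_iff split: if_splits)
qed

lemma eventually_f_nonzero: "\<forall>\<^sub>F x in at \<zeta>. f x \<noteq> 0"
  using eventually_sgn eventually_ne
  by eventually_elim (use simple in \<open>auto simp: sgn_if split: if_splits\<close>)

lemma eventually_f'_nonzero: "\<forall>\<^sub>F x in at \<zeta>. f' x \<noteq> 0"
  using tendsto_imp_eventually_ne[OF tendsto_f' simple] .

lemma eventually_moments:
  "\<forall>\<^sub>F x in at \<zeta>. gen_moment f k 1 x = - (sgn (f' \<zeta>) * sgn (x - \<zeta>)) * f' x \<and>
     gen_moment f k 2 x = of_int k * (f' x)\<^sup>2 - sgn (f' \<zeta>) * sgn (x - \<zeta>) * f'' x"
  using eventually_sgn eventually_in_S eventually_ne
proof eventually_elim
  case (elim x)
  have "(sgn (f' \<zeta>) * sgn (x - \<zeta>))\<^sup>2 = 1"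
    using elim simple by (auto simp: sgn_if)
  then show ?case
    using gen_moment_jet2[OF jet2_f[OF elim(2)], of k] elim
    by (simp add: power_mult_distrib)
qed

section \<open>One-sided moments and the error coefficient\<close>

text \<open>This is \<open>(k * f'^2 - s * f'') / (- 2 * s * f')\<close> at \<zeta> with
  \<open>s = sgn (f x)\<close>, simplified by \<open>1 / s = s\<close>. It depends on
  \<open>x\<close> only through that sign.\<close>

definition err :: "int \<Rightarrow> real \<Rightarrow> real" where
  "err k x = f'' \<zeta> / (2 * f' \<zeta>) - sgn (f x) * of_int k * f' \<zeta> / 2"

text \<open>On one side of the root the sign factor is constant, so the limits of the moments follow
  from the continuity of \<open>f'\<close> and \<open>f''\<close>.\<close>

lemma moment_at_root_eq:
  assumes "x \<noteq> \<zeta>"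
  shows "moment_at_root f k 1 \<zeta> x = - (sgn (f' \<zeta>) * sgn (x - \<zeta>)) * f' \<zeta>"
    and "moment_at_root f k 2 \<zeta> x =
      of_int k * (f' \<zeta>)\<^sup>2 - sgn (f' \<zeta>) * sgn (x - \<zeta>) * f'' \<zeta>"
proof -
  define F where "F = (if x < \<zeta> then at_left \<zeta> else at_right \<zeta>)"
  \<comment> \<open>Nontriviality of \<open>F\<close> makes limits along it unique, which is what
    determines the value of \<open>Lim\<close>.\<close>
  have F: "F \<le> at \<zeta>" "F \<noteq> bot"
    by (simp_all add: F_def at_le)
  have side: "\<forall>\<^sub>F y in F. sgn (y - \<zeta>) = sgn (x - \<zeta>)"
  proof (cases "x < \<zeta>")
    case True
    have "\<forall>\<^sub>F y in at_left \<zeta>. y < \<zeta>" by (simp add: eventually_at_filter)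
    then show ?thesis unfolding F_def using True by (auto elim: eventually_mono)
  next
    case False
    have "\<forall>\<^sub>F y in at_right \<zeta>. y > \<zeta>" by (simp add: eventually_at_filter)
    then show ?thesis unfolding F_def using False assms by (auto elim: eventually_mono)
  qed
  note ev = filter_leD[OF F(1) eventually_moments[of k]]
  have ev1: "\<forall>\<^sub>F y in F. - (sgn (f' \<zeta>) * sgn (x - \<zeta>)) * f' y = gen_moment f k 1 y"
    using ev side by eventually_elim simp
  have ev2: "\<forall>\<^sub>F y in F. of_int k * (f' y)\<^sup>2 - sgn (f' \<zeta>) * sgn (x - \<zeta>) * f'' y = gen_moment f k 2 y"
    using ev side by eventually_elim simp
  have "((\<lambda>y. gen_moment f k 1 y) \<longlongrightarrow> - (sgn (f' \<zeta>) * sgn (x - \<zeta>)) * f' \<zeta>) F"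
    by (rule Lim_transform_eventually[OF _ ev1])
      (intro tendsto_intros tendsto_mono[OF F(1) tendsto_f'])
  then show "moment_at_root f k 1 \<zeta> x = - (sgn (f' \<zeta>) * sgn (x - \<zeta>)) * f' \<zeta>"
    unfolding moment_at_root_def F_def[symmetric] by (rule tendsto_Lim[OF F(2)])
  have "((\<lambda>y. gen_moment f k 2 y) \<longlongrightarrow>
      of_int k * (f' \<zeta>)\<^sup>2 - sgn (f' \<zeta>) * sgn (x - \<zeta>) * f'' \<zeta>) F"
    by (rule Lim_transform_eventually[OF _ ev2])
      (intro tendsto_intros tendsto_mono[OF F(1) tendsto_f'] tendsto_mono[OF F(1) tendsto_f''])
  then show "moment_at_root f k 2 \<zeta> x =
      of_int k * (f' \<zeta>)\<^sup>2 - sgn (f' \<zeta>) * sgn (x - \<zeta>) * f'' \<zeta>"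
    unfolding moment_at_root_def F_def[symmetric] by (rule tendsto_Lim[OF F(2)])
qed

text \<open>The quantifier over \<open>k\<close> stands inside, so one neighbourhood serves all
  degrees and \<open>k\<close> may later be the \<open>x\<close>-dependent
  \<open>step_degree f x\<close>.\<close>

lemma eventually_err_eq:
  "\<forall>\<^sub>F x in at \<zeta>. \<forall>k. moment_at_root f k 2 \<zeta> x / (2 * moment_at_root f 0 1 \<zeta> x) = err k x"
  using eventually_sgn eventually_ne
proof eventually_elim
  case (elim x)
  define s where "s = sgn (f x)"
  have s: "s = 1 \<or> s = -1" "sgn (f' \<zeta>) * sgn (x - \<zeta>) = s"
    using elim simple by (auto simp: sgn_if s_def)
  show ?case
  proof
    fix k
    have "moment_at_root f k 2 \<zeta> x / (2 * moment_at_root f 0 1 \<zeta> x)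
        = (of_int k * (f' \<zeta>)\<^sup>2 - s * f'' \<zeta>) / (2 * (- s * f' \<zeta>))"
      unfolding moment_at_root_eq[OF elim(2)] s(2) ..
    also have "\<dots> = f'' \<zeta> / (2 * f' \<zeta>) - s * of_int k * f' \<zeta> / 2"
      using s(1) simple by (elim disjE) (simp_all add: field_simps power2_eq_square)
    finally show "moment_at_root f k 2 \<zeta> x / (2 * moment_at_root f 0 1 \<zeta> x) = err k x"
      by (simp add: err_def s_def)
  qed
qed

section \<open>Expansion of one step of fixed degree\<close>

text \<open>The Newton step, which is the case \<open>k = 0\<close>. With
  \<open>u = x - \<zeta>\<close>, the numerator \<open>u * f' x - f x\<close> equals
  \<open>u * (f' x - f' \<zeta>) - (f x - f' \<zeta> * u)\<close>; divided by \<open>u^2\<close>,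
  the two parts tend to \<open>f'' \<zeta>\<close> and \<open>f'' \<zeta> / 2\<close>.\<close>

lemma newton_remainder_tendsto:
  "((\<lambda>x. (x - \<zeta> - f x / f' x) / (x - \<zeta>)\<^sup>2) \<longlongrightarrow> f'' \<zeta> / (2 * f' \<zeta>)) (at \<zeta>)"
proof -
  have 1: "((\<lambda>x. (f' x - f' \<zeta>) / (x - \<zeta>)) \<longlongrightarrow> f'' \<zeta>) (at \<zeta>)"
    using DERIV_f'[OF root_in] by (simp add: has_field_derivative_iff)
  have 2: "((\<lambda>x. (f x - f' \<zeta> * (x - \<zeta>)) / (x - \<zeta>)\<^sup>2) \<longlongrightarrow> f'' \<zeta> / 2) (at \<zeta>)"
    using jet2_taylor[OF jet2_f[OF root_in]] by (simp add: root)
  have "((\<lambda>x. ((f' x - f' \<zeta>) / (x - \<zeta>) - (f x - f' \<zeta> * (x - \<zeta>)) / (x - \<zeta>)\<^sup>2) / f' x)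
      \<longlongrightarrow> (f'' \<zeta> - f'' \<zeta> / 2) / f' \<zeta>) (at \<zeta>)"
    by (intro tendsto_intros 1 2 tendsto_f' simple)
  then have "((\<lambda>x. ((f' x - f' \<zeta>) / (x - \<zeta>) - (f x - f' \<zeta> * (x - \<zeta>)) / (x - \<zeta>)\<^sup>2) / f' x)
      \<longlongrightarrow> f'' \<zeta> / (2 * f' \<zeta>)) (at \<zeta>)"
    by simp
  moreover have "\<forall>\<^sub>F x in at \<zeta>.
      ((f' x - f' \<zeta>) / (x - \<zeta>) - (f x - f' \<zeta> * (x - \<zeta>)) / (x - \<zeta>)\<^sup>2) / f' x
      = (x - \<zeta> - f x / f' x) / (x - \<zeta>)\<^sup>2"
    using eventually_ne eventually_f'_nonzero
  proof eventually_elim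
    case (elim x)
    have "((b - a) / u - (y - a * u) / u\<^sup>2) / b = (u - y / b) / u\<^sup>2"
      if "u \<noteq> 0" "b \<noteq> 0" for a b u y :: real
      using that by (simp add: field_simps power2_eq_square)
    with elim show ?case by simp
  qed
  ultimately show ?thesis
    by (rule Lim_transform_eventually)
qed

text \<open>What degree \<open>k\<close> adds to the Newton step, up to sign: Taylor's formula for
  \<open>degree_shift k\<close> at \<open>t = \<bar>f x\<bar>\<close>, rescaled from
  \<open>(f x)^2\<close> to \<open>(x - \<zeta>)^2\<close> by the squared slope.\<close>

lemma degree_remainder_tendsto:
  "((\<lambda>x. (degree_shift k \<bar>f x\<bar> - \<bar>f x\<bar>) / (f' x * (x - \<zeta>)\<^sup>2)) \<longlongrightarrow> of_int k * f' \<zeta> / 2) (at \<zeta>)"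
proof -
  \<comment> \<open>The Taylor limit is punctured at 0, so \<open>\<bar>f x\<bar>\<close> must tend
    to 0 without attaining it.\<close>
  have "filterlim (\<lambda>x. \<bar>f x\<bar>) (at 0) (at \<zeta>)"
    using tendsto_rabs_zero[OF tendsto_f] eventually_f_nonzero
    by (auto simp: filterlim_at)
  then have 1: "((\<lambda>x. (degree_shift k \<bar>f x\<bar> - \<bar>f x\<bar>) / (f x)\<^sup>2) \<longlongrightarrow> of_int k / 2) (at \<zeta>)"
    using filterlim_compose[OF jet2_taylor[OF jet2_degree_shift[of k]]] by fastforce
  have "((\<lambda>x. (degree_shift k \<bar>f x\<bar> - \<bar>f x\<bar>) / (f x)\<^sup>2 * (f x / (x - \<zeta>))\<^sup>2 / f' x)
      \<longlongrightarrow> of_int k / 2 * (f' \<zeta>)\<^sup>2 / f' \<zeta>) (at \<zeta>)"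
    by (intro tendsto_intros 1 slope_tendsto tendsto_f' simple)
  then have "((\<lambda>x. (degree_shift k \<bar>f x\<bar> - \<bar>f x\<bar>) / (f x)\<^sup>2 * (f x / (x - \<zeta>))\<^sup>2 / f' x)
      \<longlongrightarrow> of_int k * f' \<zeta> / 2) (at \<zeta>)"
    using simple by (simp add: power2_eq_square)
  moreover have "\<forall>\<^sub>F x in at \<zeta>.
      (degree_shift k \<bar>f x\<bar> - \<bar>f x\<bar>) / (f x)\<^sup>2 * (f x / (x - \<zeta>))\<^sup>2 / f' x
      = (degree_shift k \<bar>f x\<bar> - \<bar>f x\<bar>) / (f' x * (x - \<zeta>)\<^sup>2)"
    using eventually_f_nonzero by eventually_elim (simp add: power_divide)
  ultimately show ?thesis
    by (rule Lim_transform_eventually)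
qed

text \<open>With \<open>s = sgn (f x)\<close> and \<open>s * \<bar>f x\<bar> = f x\<close>, the new
  error is the Newton remainder minus \<open>s\<close> times the degree remainder.\<close>

lemma fixed_degree_error:
  "((\<lambda>x. (x + root_value f k x / gen_moment f 0 1 x - \<zeta>) / (x - \<zeta>)\<^sup>2 - err k x) \<longlongrightarrow> 0) (at \<zeta>)"
proof -
  let ?N = "\<lambda>x. (x - \<zeta> - f x / f' x) / (x - \<zeta>)\<^sup>2 - f'' \<zeta> / (2 * f' \<zeta>)"
  let ?D = "\<lambda>x. (degree_shift k \<bar>f x\<bar> - \<bar>f x\<bar>) / (f' x * (x - \<zeta>)\<^sup>2) - of_int k * f' \<zeta> / 2"
  have N: "(?N \<longlongrightarrow> 0) (at \<zeta>)"
    using newton_remainder_tendsto by (simp add: LIM_zero_iff)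
  have "(?D \<longlongrightarrow> 0) (at \<zeta>)"
    using degree_remainder_tendsto by (simp add: LIM_zero_iff)
  \<comment> \<open>The sign takes opposite values on the two sides of \<zeta> and has no limit
    there. It is bounded by 1, so its product with a null function is null.\<close>
  then have D: "((\<lambda>x. sgn (f x) * ?D x) \<longlongrightarrow> 0) (at \<zeta>)"
    by (rule Lim_null_comparison[rotated, OF tendsto_norm_zero])
      (auto intro!: always_eventually simp: abs_mult sgn_if)
  have "((\<lambda>x. ?N x - sgn (f x) * ?D x) \<longlongrightarrow> 0) (at \<zeta>)"
    using tendsto_diff[OF N D] by simp
  moreover have "\<forall>\<^sub>F x in at \<zeta>. ?N x - sgn (f x) * ?D x
      = (x + root_value f k x / gen_moment f 0 1 x - \<zeta>) / (x - \<zeta>)\<^sup>2 - err k x"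
    using eventually_ne eventually_f'_nonzero eventually_f_nonzero eventually_in_S
  proof eventually_elim
    case (elim x)
    define u where "u = x - \<zeta>"
    define s where "s = sgn (f x)"
    define d where "d = degree_shift k \<bar>f x\<bar>"
    have u: "u \<noteq> 0" using elim by (simp add: u_def)
    have s: "s = 1 \<and> \<bar>f x\<bar> = f x \<or> s = -1 \<and> \<bar>f x\<bar> = - f x"
      using elim by (auto simp: s_def sgn_if)
    have "gen_moment f 0 1 x = - s * f' x"
      using gen_moment_jet2(1)[OF jet2_f[OF elim(4)], of 0] by (simp add: s_def)
    moreover have "x + c - \<zeta> = u + c" for c by (simp add: u_def)
    ultimately show ?case
      unfolding root_value_def err_def s_def[symmetric] d_def[symmetric] u_def[symmetric]
      using s u elim(2) by (auto simp: field_simps)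
  qed
  ultimately show ?thesis
    by (rule Lim_transform_eventually)
qed

section \<open>Uniformity in the degree and the error equation\<close>

text \<open>Near \<zeta> the rounded quantity has absolute value
  \<open>\<bar>f'' x / (f' x)^2\<bar>\<close>, which converges as \<open>x\<close> tends to
  \<zeta>.\<close>

lemma step_degree_bounded: "\<exists>K. \<forall>\<^sub>F x in at \<zeta>. step_degree f x \<in> {-K..K}"
proof -
  define B where "B = \<bar>f'' \<zeta> / (f' \<zeta>)\<^sup>2\<bar> + 1"
  have "((\<lambda>x. \<bar>f'' x / (f' x)\<^sup>2\<bar>) \<longlongrightarrow> \<bar>f'' \<zeta> / (f' \<zeta>)\<^sup>2\<bar>) (at \<zeta>)"
    by (intro tendsto_intros tendsto_f' tendsto_f'') (use simple in auto)
  then have "\<forall>\<^sub>F x in at \<zeta>. \<bar>f'' x / (f' x)\<^sup>2\<bar> < B"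
    by (rule order_tendstoD(2)) (simp add: B_def)
  \<comment> \<open>The extra 1 beyond the ceiling absorbs the rounding error, which is at most
    1/2.\<close>
  then have "\<forall>\<^sub>F x in at \<zeta>. step_degree f x \<in> {- (\<lceil>B\<rceil> + 1)..\<lceil>B\<rceil> + 1}"
    using eventually_moments[of 0] eventually_ne
  proof eventually_elim
    case (elim x)
    define q where "q = gen_moment f 0 2 x / (gen_moment f 0 1 x)\<^sup>2"
    have s: "\<bar>sgn (f' \<zeta>) * sgn (x - \<zeta>)\<bar> = 1"
      using elim(3) simple by (auto simp: sgn_if)
    then have "(sgn (f' \<zeta>) * sgn (x - \<zeta>))\<^sup>2 = 1"
      by (metis power2_abs one_power2)
    then have "q = - (sgn (f' \<zeta>) * sgn (x - \<zeta>)) * (f'' x / (f' x)\<^sup>2)"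
      unfolding q_def using elim(2) by (simp add: power_mult_distrib)
    then have "\<bar>q\<bar> = \<bar>f'' x / (f' x)\<^sup>2\<bar>"
      using s by (simp only: abs_mult abs_minus_cancel)
    then have "\<bar>q\<bar> < B" using elim(1) by simp
    moreover have "B \<le> of_int \<lceil>B\<rceil>" by simp
    ultimately have "\<bar>of_int (round q) :: real\<bar> \<le> of_int (\<lceil>B\<rceil> + 1)"
      using of_int_round_abs_le[of q] unfolding of_int_add of_int_1 by linarith
    then have "\<bar>round q\<bar> \<le> \<lceil>B\<rceil> + 1"
      by (simp only: of_int_abs[symmetric] of_int_le_iff)
    then show ?case
      unfolding step_degree_def q_def[symmetric] by auto
  qed
  then show ?thesis by blast
qed

lemma step_error_tendsto:
  "((\<lambda>x. (next_iterate f x - \<zeta>) / (x - \<zeta>)\<^sup>2 - err (step_degree f x) x) \<longlongrightarrow> 0) (at \<zeta>)"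
proof (rule tendstoI)
  fix e :: real assume "e > 0"
  obtain K where K: "\<forall>\<^sub>F x in at \<zeta>. step_degree f x \<in> {-K..K}"
    using step_degree_bounded by blast
  \<comment> \<open>Finitely many degrees share a common neighbourhood; the degree actually chosen
    at \<open>x\<close> is then one of them.\<close>
  have "\<forall>\<^sub>F x in at \<zeta>. \<forall>k\<in>{-K..K}.
      dist ((x + root_value f k x / gen_moment f 0 1 x - \<zeta>) / (x - \<zeta>)\<^sup>2 - err k x) 0 < e"
    by (intro eventually_ball_finite ballI tendstoD[OF fixed_degree_error \<open>e > 0\<close>]) simp
  with K show "\<forall>\<^sub>F x in at \<zeta>.
      dist ((next_iterate f x - \<zeta>) / (x - \<zeta>)\<^sup>2 - err (step_degree f x) x) 0 < e"
    by eventually_elim (simp add: next_iterate_def)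
qed

text \<open>Multiplying the limit in \<open>step_error_tendsto\<close> by
  \<open>(x - \<zeta>)^2\<close> gives the little-o bound, and \<open>eventually_err_eq\<close>
  turns \<open>err\<close> into the quotient of moments.\<close>

lemma error_equation:
  "(\<lambda>x. (next_iterate f x - \<zeta>)
      - moment_at_root f (step_degree f x) 2 \<zeta> x / (2 * moment_at_root f 0 1 \<zeta> x) * (x - \<zeta>)\<^sup>2)
    \<in> o[at \<zeta>](\<lambda>x. (x - \<zeta>)\<^sup>2)"
proof (rule landau_o.smallI)
  fix c :: real assume "c > 0"
  from tendstoD[OF step_error_tendsto this] eventually_err_eq eventually_ne
  show "\<forall>\<^sub>F x in at \<zeta>. norm ((next_iterate f x - \<zeta>)
      - moment_at_root f (step_degree f x) 2 \<zeta> x / (2 * moment_at_root f 0 1 \<zeta> x) * (x - \<zeta>)\<^sup>2)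
    \<le> c * norm ((x - \<zeta>)\<^sup>2)"
  proof eventually_elim
    case (elim x)
    define u where "u = (x - \<zeta>)\<^sup>2"
    define m where "m = err (step_degree f x) x"
    have u: "u > 0" using elim by (simp add: u_def)
    have "(next_iterate f x - \<zeta>) - m * u = ((next_iterate f x - \<zeta>) / u - m) * u"
      using u by (simp add: field_simps)
    moreover have "\<bar>(next_iterate f x - \<zeta>) / u - m\<bar> \<le> c"
      using elim(1) by (simp add: u_def m_def)
    ultimately have "\<bar>(next_iterate f x - \<zeta>) - m * u\<bar> \<le> c * u"
      using u by (simp add: abs_mult mult_right_mono)
    then show ?case
      using elim(2) u unfolding u_def[symmetric] m_def by simp
  qed
qed

section \<open>Local quadratic convergence\<close>

text \<open>At the root \<open>sgn 0 = 0\<close> makes the denominator vanish, as does the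
  numerator; with \<open>0 / 0 = 0\<close> the increment is 0, so a sequence that hits \<zeta> stays
  there.\<close>

lemma next_iterate_root [simp]: "next_iterate f \<zeta> = \<zeta>"
  by (simp add: next_iterate_def root_value_def root)

lemma quadratic_bound:
  "\<exists>C>0. \<forall>\<^sub>F x in at \<zeta>. \<bar>next_iterate f x - \<zeta>\<bar> \<le> C * \<bar>x - \<zeta>\<bar>\<^sup>2"
proof -
  obtain K where K: "\<forall>\<^sub>F x in at \<zeta>. step_degree f x \<in> {-K..K}"
    using step_degree_bounded by blast
  \<comment> \<open>The first two summands bound the two terms of \<open>err\<close> for every
    degree in \<open>{-K..K}\<close>; the final 1 covers the distance of the error quotient from
    \<open>err\<close>.\<close>
  define C where "C = \<bar>f'' \<zeta> / (2 * f' \<zeta>)\<bar> + of_int \<bar>K\<bar> * \<bar>f' \<zeta>\<bar> / 2 + 1"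
  have C: "C > 0" unfolding C_def by (intro add_nonneg_pos add_nonneg_nonneg) auto
  from K tendstoD[OF step_error_tendsto zero_less_one] eventually_ne
  have "\<forall>\<^sub>F x in at \<zeta>. \<bar>next_iterate f x - \<zeta>\<bar> \<le> C * \<bar>x - \<zeta>\<bar>\<^sup>2"
  proof eventually_elim
    case (elim x)
    define k where "k = step_degree f x"
    have "\<bar>sgn (f x) * of_int k * f' \<zeta> / 2\<bar> \<le> of_int \<bar>K\<bar> * \<bar>f' \<zeta>\<bar> / 2"
    proof -
      have "\<bar>k\<bar> \<le> \<bar>K\<bar>" using elim(1) by (auto simp: k_def)
      then have "\<bar>of_int k :: real\<bar> \<le> of_int \<bar>K\<bar>"
        by (metis of_int_abs of_int_le_iff)
      moreover have "\<bar>sgn (f x) * of_int k\<bar> \<le> \<bar>of_int k :: real\<bar>"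
        by (simp add: abs_mult sgn_if)
      ultimately have "\<bar>sgn (f x) * of_int k\<bar> \<le> of_int \<bar>K\<bar>" by linarith
      from mult_right_mono[OF this, of "\<bar>f' \<zeta>\<bar>"] show ?thesis by (simp add: abs_mult)
    qed
    then have "\<bar>err k x\<bar> \<le> C - 1"
      unfolding err_def C_def by linarith
    moreover have "\<bar>(next_iterate f x - \<zeta>) / (x - \<zeta>)\<^sup>2 - err k x\<bar> < 1"
      using elim(2) by (simp add: k_def)
    ultimately have "\<bar>(next_iterate f x - \<zeta>) / (x - \<zeta>)\<^sup>2\<bar> \<le> C" by linarith
    then show ?case using elim(3) by (simp add: abs_divide divide_le_eq)
  qed
  with C show ?thesis by blast
qed

text \<open>On a small enough ball the quadratic bound at least halves the error, so iterates remain
  in the ball and converge geometrically. Both \<delta> and \<open>C\<close> are fixed before the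
  sequence.\<close>

lemma quadratic_convergence:
  "\<exists>\<delta>>0. \<exists>C. ball \<zeta> \<delta> \<subseteq> S \<and>
     (\<forall>x :: nat \<Rightarrow> real.
        x 0 \<in> ball \<zeta> \<delta> \<and> (\<forall>n. x (Suc n) = next_iterate f (x n)) \<longrightarrow>
          (\<forall>n. x n \<in> ball \<zeta> \<delta>) \<and>
          (\<forall>n. x n \<noteq> \<zeta> \<longrightarrow> gen_moment f 0 1 (x n) \<noteq> 0) \<and>
          x \<longlonglongrightarrow> \<zeta> \<and>
          (\<forall>n. \<bar>x (Suc n) - \<zeta>\<bar> \<le> C * \<bar>x n - \<zeta>\<bar>\<^sup>2))"
proof -
  obtain C where C: "C > 0" and bound: "\<forall>\<^sub>F x in at \<zeta>. \<bar>next_iterate f x - \<zeta>\<bar> \<le> C * \<bar>x - \<zeta>\<bar>\<^sup>2"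
    using quadratic_bound by blast
  have "\<forall>\<^sub>F x in at \<zeta>. \<bar>next_iterate f x - \<zeta>\<bar> \<le> C * \<bar>x - \<zeta>\<bar>\<^sup>2 \<and> x \<in> S \<and> gen_moment f 0 1 x \<noteq> 0"
    using bound eventually_in_S eventually_moments[of 0] eventually_f'_nonzero eventually_ne
    by eventually_elim (use simple in \<open>auto simp: sgn_zero_iff\<close>)
  then obtain d where d: "d > 0" and near: "\<And>x. x \<noteq> \<zeta> \<Longrightarrow> dist x \<zeta> < d \<Longrightarrow>
      \<bar>next_iterate f x - \<zeta>\<bar> \<le> C * \<bar>x - \<zeta>\<bar>\<^sup>2 \<and> x \<in> S \<and> gen_moment f 0 1 x \<noteq> 0"
    unfolding eventually_at by blast
  \<comment> \<open>The second bound ensures \<open>C * \<delta> \<le> 1 / 2\<close>, turning one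
    factor of the squared error into 1/2.\<close>
  define \<delta> where "\<delta> = min d (1 / (2 * C))"
  have \<delta>: "\<delta> > 0" "\<delta> \<le> d" "C * \<delta> \<le> 1 / 2"
    using d C by (auto simp: \<delta>_def min_def field_simps)
  \<comment> \<open>The estimate \<open>near\<close> excludes \<zeta>; there the fixed-point
    property gives the bound.\<close>
  have quad: "\<bar>next_iterate f y - \<zeta>\<bar> \<le> C * \<bar>y - \<zeta>\<bar>\<^sup>2" if "y \<in> ball \<zeta> \<delta>" for y
    using near[of y] that \<delta> by (cases "y = \<zeta>") (auto simp: dist_commute)
  have half: "\<bar>next_iterate f y - \<zeta>\<bar> \<le> \<bar>y - \<zeta>\<bar> / 2" if "y \<in> ball \<zeta> \<delta>" for y
  proof -
    have "C * \<bar>y - \<zeta>\<bar> \<le> C * \<delta>"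
      using that C by (intro mult_left_mono) (auto simp: dist_real_def)
    then have "C * \<bar>y - \<zeta>\<bar> \<le> 1 / 2" using \<delta>(3) by linarith
    from mult_right_mono[OF this, of "\<bar>y - \<zeta>\<bar>"]
    have "C * \<bar>y - \<zeta>\<bar>\<^sup>2 \<le> \<bar>y - \<zeta>\<bar> / 2"
      unfolding power2_eq_square by (simp only: mult.assoc abs_ge_zero) simp
    with quad[OF that] show ?thesis by linarith
  qed
  have sub: "ball \<zeta> \<delta> \<subseteq> S"
  proof
    fix y assume "y \<in> ball \<zeta> \<delta>"
    then show "y \<in> S"
      using near[of y] root_in \<delta> by (cases "y = \<zeta>") (auto simp: dist_commute)
  qed
  have conv: "(\<forall>n. x n \<in> ball \<zeta> \<delta>) \<and> (\<forall>n. x n \<noteq> \<zeta> \<longrightarrow> gen_moment f 0 1 (x n) \<noteq> 0) \<and>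
      x \<longlonglongrightarrow> \<zeta> \<and> (\<forall>n. \<bar>x (Suc n) - \<zeta>\<bar> \<le> C * \<bar>x n - \<zeta>\<bar>\<^sup>2)"
    if x: "x 0 \<in> ball \<zeta> \<delta>" "\<And>n. x (Suc n) = next_iterate f (x n)" for x :: "nat \<Rightarrow> real"
  proof -
    \<comment> \<open>Membership and decay are proved together, because halving is available only
      inside the ball.\<close>
    have geo: "x n \<in> ball \<zeta> \<delta> \<and> \<bar>x n - \<zeta>\<bar> \<le> \<delta> * (1 / 2) ^ n" for n
    proof (induction n)
      case 0
      then show ?case using x(1) by (auto simp: dist_real_def)
    next
      case (Suc n)
      then have step: "\<bar>x (Suc n) - \<zeta>\<bar> \<le> \<bar>x n - \<zeta>\<bar> / 2"
        using half[of "x n"] x(2) by simp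
      have "\<bar>x n - \<zeta>\<bar> < \<delta>"
        using Suc by (simp add: dist_real_def abs_minus_commute)
      then have "\<bar>x n - \<zeta>\<bar> / 2 < \<delta>" using \<delta>(1) by simp
      with step have "\<bar>x (Suc n) - \<zeta>\<bar> < \<delta>" by (rule order.strict_trans1)
      with step Suc show ?case
        by (simp add: dist_real_def abs_minus_commute)
    qed
    have "(\<lambda>n. \<delta> * (1 / 2) ^ n) \<longlonglongrightarrow> \<delta> * 0"
      by (intro tendsto_intros LIMSEQ_power_zero) simp
    then have lim: "(\<lambda>n. \<delta> * (1 / 2) ^ n) \<longlonglongrightarrow> 0"
      unfolding mult_zero_right .
    have "norm (x n - \<zeta>) \<le> \<delta> * (1 / 2) ^ n" for n
      unfolding real_norm_def using geo by (rule conjunct2)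
    from Lim_null_comparison[OF always_eventually[OF allI[OF this]] lim]
    have "(\<lambda>n. x n - \<zeta>) \<longlonglongrightarrow> 0" .
    then have "x \<longlonglongrightarrow> \<zeta>" by (simp add: LIM_zero_iff)
    moreover have "gen_moment f 0 1 (x n) \<noteq> 0" if "x n \<noteq> \<zeta>" for n
      using near[OF that] geo[of n] \<delta> by (auto simp: dist_commute)
    moreover have "\<bar>x (Suc n) - \<zeta>\<bar> \<le> C * \<bar>x n - \<zeta>\<bar>\<^sup>2" for n
      unfolding x(2) using geo quad by blast
    ultimately show ?thesis
      using geo by blast
  qed
  show ?thesis
    by (rule exI[of _ \<delta>], rule conjI[OF \<delta>(1)], rule exI[of _ C], rule conjI[OF sub])
      (intro allI impI, elim conjE, rule conv, assumption, erule spec)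
qed

end

text \<open>The error equation is read to leading order, with remainder
  \<open>o((x - \<zeta>)^2)\<close>. The locale is instantiated at the open set
  \<open>interior I\<close>, and a ball inside it lies in \<open>I\<close>.\<close>

theorem theorem3p1:
  fixes f f' f'' :: "real \<Rightarrow> real" and I :: "real set" and \<zeta> :: real
  assumes "\<zeta> \<in> interior I"
    and "\<And>x. x \<in> interior I \<Longrightarrow> (f has_real_derivative f' x) (at x)"
    and "\<And>x. x \<in> interior I \<Longrightarrow> (f' has_real_derivative f'' x) (at x)"
    and "continuous_on (interior I) f''"
    and "f \<zeta> = 0"
    and "f' \<zeta> \<noteq> 0"
  shows "(\<exists>\<delta>>0. \<exists>C. ball \<zeta> \<delta> \<subseteq> I \<and>
           (\<forall>x :: nat \<Rightarrow> real.
              x 0 \<in> ball \<zeta> \<delta> \<and> (\<forall>n. x (Suc n) = next_iterate f (x n)) \<longrightarrow>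
                (\<forall>n. x n \<in> ball \<zeta> \<delta>) \<and>
                (\<forall>n. x n \<noteq> \<zeta> \<longrightarrow> gen_moment f 0 1 (x n) \<noteq> 0) \<and>
                x \<longlonglongrightarrow> \<zeta> \<and>
                (\<forall>n. \<bar>x (Suc n) - \<zeta>\<bar> \<le> C * \<bar>x n - \<zeta>\<bar>\<^sup>2)))
       \<and> (\<lambda>x. (next_iterate f x - \<zeta>)
               - moment_at_root f (step_degree f x) 2 \<zeta> x
                   / (2 * moment_at_root f 0 1 \<zeta> x) * (x - \<zeta>)\<^sup>2)
           \<in> o[at \<zeta>](\<lambda>x. (x - \<zeta>)\<^sup>2)"
proof -
  interpret simple_root f f' f'' "interior I" \<zeta>
    by unfold_locales (use assms in auto)
  have sub: "ball \<zeta> \<delta> \<subseteq> I" if "ball \<zeta> \<delta> \<subseteq> interior I" for \<delta>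
    using that interior_subset by (rule subset_trans)
  from quadratic_convergence show ?thesis
    by (intro conjI error_equation) (elim exE conjE, intro exI conjI, assumption, erule sub, assumption)
qed

end
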